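(* Let $(Y,\mathbf{X})$ be a $(d+1)$-dimensional random vector such that the distribution function $F_Y$ of $Y$ is continuous. The following statements are equivalent: (i) There exists some $t\in(0,1]$ such that $\kappa_{(Y,\mathbf{X})}(t)=0$. (ii) $\kappa_{(Y,\mathbf{X})}(1)=0$. (iii) $Y$ and $\mathbf{X}$ are independent. (iv) $\kappa_{(Y,\mathbf{X})}(1)=\kappa^{\perp}_{(Y,\mathbf{X})}(1)$.
   Context: $Y$ is real-valued and $\mathbf{X}$ takes values in $\mathbb{R}^d$, $d\ge 1$. $Y'$ is a random variable (on a possibly extended probability space) such that, conditionally on $\mathbf{X}$, $Y$ and $Y'$ are independent and identically distributed, i.e. $\mathbb{P}(Y\in A, Y'\in B\mid \mathbf{X})=\mathbb{P}(Y\in A\mid\mathbf{X})\,\mathbb{P}(Y\in B\mid\mathbf{X})$ almost surely for all Borel sets $A,B\subseteq\mathbb{R}$. For $t\in[0,1]$, $$\phi_{(Y,\mathbf{X})}(t):=\mathbb{P}\bigl(|F_Y(Y)-F_Y(Y')|\le t\bigr),\qquad \kappa_{(Y,\mathbf{X})}(t):=1-3\int_0^t\bigl(1-\phi_{(Y,\mathbf{X})}(s)\bigr)\,\mathrm{d}s.$$ The function $\kappa^{\perp}_{(Y,\mathbf{X})}$ (the one corresponding to independence) is $\kappa^{\perp}_{(Y,\mathbf{X})}(t):=(1-t)^3$ for $t\in[0,1]$. *)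

theory Defs
  imports "HOL-Probability.Probability"
begin

definition cond_prob_given ::
    "'a measure \<Rightarrow> ('a \<Rightarrow> 'b::topological_space) \<Rightarrow> 'a set \<Rightarrow> 'a \<Rightarrow> real" where
  "cond_prob_given N X E =
     real_cond_exp N (vimage_algebra (space N) X borel) (indicator E)"

definition cond_iid_copy ::
    "'a measure \<Rightarrow> ('a \<Rightarrow> real) \<Rightarrow> ('a \<Rightarrow> real) \<Rightarrow> ('a \<Rightarrow> 'b::topological_space) \<Rightarrow> bool" where
  "cond_iid_copy N Y Y' X \<longleftrightarrow>
     Y' \<in> borel_measurable N \<and>
     (\<forall>A\<in>sets borel. \<forall>B\<in>sets borel. AE \<omega> in N.
        cond_prob_given N X {\<omega>\<in>space N. Y \<omega> \<in> A \<and> Y' \<omega> \<in> B} \<omega> =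
        cond_prob_given N X {\<omega>\<in>space N. Y \<omega> \<in> A} \<omega> *
        cond_prob_given N X {\<omega>\<in>space N. Y \<omega> \<in> B} \<omega>)"

definition extends_prob_space :: "'a measure \<Rightarrow> 'b measure \<Rightarrow> ('b \<Rightarrow> 'a) \<Rightarrow> bool" where
  "extends_prob_space M N p \<longleftrightarrow> prob_space N \<and> p \<in> measurable N M \<and> distr N M p = M"

abbreviation dist_fun :: "'a measure \<Rightarrow> ('a \<Rightarrow> real) \<Rightarrow> real \<Rightarrow> real" where
  "dist_fun M Y \<equiv> cdf (distr M borel Y)"

(* The law of (Y, Y') is determined by that of (Y, X), so phi and kappa do not depend on the
   choice of the conditional copy Y'; they depend on X through Y' only. *)

definition phi :: "'a measure \<Rightarrow> ('a \<Rightarrow> real) \<Rightarrow> ('a \<Rightarrow> real) \<Rightarrow> real \<Rightarrow> real" where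
  "phi N Y Y' t = \<P>(\<omega> in N. \<bar>dist_fun N Y (Y \<omega>) - dist_fun N Y (Y' \<omega>)\<bar> \<le> t)"

definition kappa :: "'a measure \<Rightarrow> ('a \<Rightarrow> real) \<Rightarrow> ('a \<Rightarrow> real) \<Rightarrow> real \<Rightarrow> real" where
  "kappa N Y Y' t = 1 - 3 * (LINT s:{0..t}|lborel. 1 - phi N Y Y' s)"

definition kappa_indep :: "real \<Rightarrow> real" where
  "kappa_indep t = (1 - t) ^ 3"

(* The library's indep_var forces both variables to have the same codomain type, hence
   independence is expressed through the generated sigma-algebras. *)

definition indep_rv ::
    "'a measure \<Rightarrow> ('a \<Rightarrow> 'b::topological_space) \<Rightarrow> ('a \<Rightarrow> 'c::topological_space) \<Rightarrow> bool" where
  "indep_rv M Y X \<longleftrightarrow>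
     prob_space.indep_set M
       {Y -` A \<inter> space M | A. A \<in> sets borel} {X -` B \<inter> space M | B. B \<in> sets borel}"

end

theory Submission
  imports Defs
begin

text \<open>
  Write \<open>F\<close> for the continuous distribution function of \<open>Y\<close> and put \<open>U = F Y\<close>, \<open>U' = F Y'\<close>.
  Since \<open>Y'\<close> has the law of \<open>Y\<close>, both \<open>U\<close> and \<open>U'\<close> are uniform on \<open>[0,1]\<close>. Integrating
  the tail \<open>1 - \<phi>\<close> gives the mean of \<open>\<bar>U - U'\<bar>\<close>, so \<open>\<kappa>(1) = 1 - 3 E\<bar>U - U'\<bar>\<close>.
  Because \<open>\<bar>U - U'\<bar> = 2 max U U' - U - U'\<close>, this mean depends only on the law of
  \<open>max U U'\<close>, and expressing it through the distribution function turns \<open>\<kappa>(1)\<close> into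
  \<open>6 \<integral>\<^sub>0\<^sup>1 (P(U \<le> u, U' \<le> u) - u\<^sup>2) du\<close> (lemma \<open>kappa_1_eq\<close>).

  Let \<open>h u = P(U \<le> u | X)\<close>, which has mean \<open>u\<close>. By conditional independence
  \<open>P(U \<le> u, U' \<le> u)\<close> is the mean of \<open>(h u)\<^sup>2\<close>, so the integrand is the variance of
  \<open>h u\<close> (lemma \<open>variance_h\<close>). Hence \<open>\<kappa>(1) \<ge> 0\<close>. If \<open>\<kappa>(1) = 0\<close>, the integrand vanishes almost
  everywhere, and right-continuity of the distribution function of \<open>max U U'\<close> makes it
  vanish for every \<open>u\<close>. So every \<open>h u\<close> is almost surely the constant \<open>u\<close>, which says that
  the events \<open>U \<le> u\<close> are independent of \<open>X\<close>; up to null sets these include all events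
  \<open>Y \<le> y\<close> (lemma \<open>indep_iff_h_const\<close>). The argument reverses.

  Finally \<open>\<kappa>\<close> is antitone on \<open>[0,1]\<close>. A zero at any \<open>t\<close> therefore forces \<open>\<kappa>(1) \<le> 0\<close>, and
  nonnegativity gives \<open>\<kappa>(1) = 0\<close>. The comparison with \<open>(1 - t)\<^sup>3\<close> at \<open>t = 1\<close> is
  the same equation, as that curve vanishes there.
\<close>

section \<open>Tail integrals and the probability integral transform\<close>

context prob_space begin

text \<open>Layer-cake formula: \<open>Z \<omega>\<close> is the length of \<open>{s. 0 \<le> s < Z \<omega>}\<close>, and Tonelli's theorem
  exchanges this length with the expectation.\<close>

lemma expectation_eq_integral_tail:
  assumes [measurable]: "Z \<in> borel_measurable M"
    and bounds: "\<And>\<omega>. \<omega> \<in> space M \<Longrightarrow> 0 \<le> Z \<omega> \<and> Z \<omega> \<le> 1"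
  shows "expectation Z = (LINT s:{0..1}|lborel. 1 - \<P>(\<omega> in M. Z \<omega> \<le> s))"
proof -
  interpret P: pair_sigma_finite M "lborel :: real measure"
    by unfold_locales
  have tail: "(\<integral>\<^sup>+\<omega>. indicator {0..1} s * indicator {s<..} (Z \<omega>) \<partial>M)
      = ennreal (indicator {0..1} s * (1 - \<P>(\<omega> in M. Z \<omega> \<le> s)))" for s :: real
  proof -
    have "(\<integral>\<^sup>+\<omega>. indicator {0..1} s * indicator {s<..} (Z \<omega>) \<partial>M)
        = indicator {0..1} s * (\<integral>\<^sup>+\<omega>. indicator {\<omega> \<in> space M. s < Z \<omega>} \<omega> \<partial>M)"
      by (subst nn_integral_cmult[symmetric]) (auto intro!: nn_integral_cong simp: indicator_def)
    also have "\<dots> = indicator {0..1} s * ennreal (\<P>(\<omega> in M. s < Z \<omega>))"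
      by (simp add: emeasure_eq_measure)
    also have "\<P>(\<omega> in M. s < Z \<omega>) = 1 - \<P>(\<omega> in M. Z \<omega> \<le> s)"
      by (subst prob_neg[symmetric]) (auto simp: not_le)
    finally show ?thesis
      by (simp add: indicator_def)
  qed
  have meas: "(\<lambda>s. \<P>(\<omega> in M. Z \<omega> \<le> s)) \<in> borel_measurable lborel"
    by (auto intro!: borel_measurable_mono monoI finite_measure_mono)
  have "ennreal (expectation Z) = (\<integral>\<^sup>+\<omega>. ennreal (Z \<omega>) \<partial>M)"
    using bounds by (intro nn_integral_eq_integral[symmetric] integrable_const_bound[of _ 1]) auto
  also have "\<dots> = (\<integral>\<^sup>+\<omega>. (\<integral>\<^sup>+s. indicator {0..1} s * indicator {s<..} (Z \<omega>) \<partial>lborel) \<partial>M)"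
  proof (rule nn_integral_cong)
    fix \<omega> assume "\<omega> \<in> space M"
    then have "(\<integral>\<^sup>+s. indicator {0..1} s * indicator {s<..} (Z \<omega>) \<partial>lborel)
        = (\<integral>\<^sup>+s. indicator {0..<Z \<omega>} s \<partial>lborel)"
      using bounds[of \<omega>] by (intro nn_integral_cong) (auto simp: indicator_def)
    then show "ennreal (Z \<omega>) = (\<integral>\<^sup>+s. indicator {0..1} s * indicator {s<..} (Z \<omega>) \<partial>lborel)"
      using bounds[OF \<open>\<omega> \<in> space M\<close>] by simp
  qed
  also have "\<dots> = (\<integral>\<^sup>+s. (\<integral>\<^sup>+\<omega>. indicator {0..1} s * indicator {s<..} (Z \<omega>) \<partial>M) \<partial>lborel)"
  proof (rule P.Fubini'[symmetric])
    have "(\<lambda>(\<omega>, s). indicator {0..1} s * indicator {x :: real \<times> real. fst x < snd x} (s, Z \<omega>) :: ennreal)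
      \<in> borel_measurable (M \<Otimes>\<^sub>M lborel)" by measurable
    then show "(\<lambda>(\<omega>, s). indicator {0..1} s * indicator {s<..} (Z \<omega>) :: ennreal)
      \<in> borel_measurable (M \<Otimes>\<^sub>M lborel)"
      by (simp add: indicator_def)
  qed
  also have "\<dots> = (\<integral>\<^sup>+s. ennreal (indicator {0..1} s * (1 - \<P>(\<omega> in M. Z \<omega> \<le> s))) \<partial>lborel)"
    by (simp only: tail)
  finally have *: "ennreal (expectation Z) = \<dots>" .
  have "(LINT s:{0..1}|lborel. 1 - \<P>(\<omega> in M. Z \<omega> \<le> s))
      = enn2real (\<integral>\<^sup>+s. ennreal (indicator {0..1} s * (1 - \<P>(\<omega> in M. Z \<omega> \<le> s))) \<partial>lborel)"
    unfolding set_lebesgue_integral_def real_scaleR_def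
    using meas by (intro integral_eq_nn_integral) (auto simp: indicator_def)
  also have "\<dots> = expectation Z"
    unfolding *[symmetric] using bounds by (intro enn2real_ennreal integral_nonneg) auto
  finally show ?thesis ..
qed

text \<open>For \<open>0 < u < 1\<close> the continuous nondecreasing function \<open>F\<close> takes the value \<open>u\<close>, and
  the set \<open>{z. F z \<le> u}\<close> is a closed half-line whose end point also has value \<open>u\<close>; the event
  \<open>F Y \<le> u\<close> is thus of the form \<open>Y \<le> z\<close> with \<open>F z = u\<close>. At \<open>u = 0\<close> the value need not be
  attained, and the claim follows by letting \<open>u\<close> decrease to 0.\<close>
lemma prob_integral_transform:
  assumes [measurable]: "Y \<in> borel_measurable M"
    and cont: "continuous_on UNIV (dist_fun M Y)"
    and u: "0 \<le> u" "u \<le> 1"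
  shows "\<P>(\<omega> in M. dist_fun M Y (Y \<omega>) \<le> u) = u"
proof -
  interpret D: real_distribution "distr M borel Y" by simp
  let ?F = "dist_fun M Y"
  have [measurable]: "?F \<in> borel_measurable borel"
    using cont by (rule borel_measurable_continuous_onI)
  have F_eq: "?F y = \<P>(\<omega> in M. Y \<omega> \<le> y)" for y
    by (simp add: cdf_def measure_distr vimage_def Int_def conj_commute)
  have inner: "\<P>(\<omega> in M. ?F (Y \<omega>) \<le> v) = v" if v: "0 < v" "v < 1" for v
  proof -
    obtain a where a: "?F a < v"
      using order_tendstoD(2)[OF D.cdf_lim_at_bot v(1)] by (auto simp: eventually_at_bot_linorder)
    obtain b where b: "?F b > v"
      using order_tendstoD(1)[OF D.cdf_lim_at_top_prob v(2)] by (auto simp: eventually_at_top_linorder)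
    have "a \<le> b"
      using a b D.cdf_nondecreasing[of b a] by (meson linorder_le_cases not_le order.trans order_less_imp_le)
    then obtain y where y: "?F y = v"
      using IVT'[of ?F a v b] a b cont by (meson continuous_on_subset less_imp_le subset_UNIV)
    define S where "S = {z. ?F z \<le> v}"
    have bdd: "bdd_above S"
      using b D.cdf_nondecreasing unfolding S_def
      by (intro bdd_aboveI[of _ b]) (metis linorder_le_cases mem_Collect_eq not_le order.trans)
    have "closed S"
      unfolding S_def using cont by (intro closed_Collect_le) auto
    moreover have yS: "y \<in> S" by (simp add: S_def y)
    ultimately have sup: "Sup S \<in> S"
      using bdd by (intro closed_contains_Sup) auto
    have S_eq: "S = {..Sup S}"
      using sup bdd D.cdf_nondecreasing unfolding S_def
      by (auto intro: cSup_upper order.trans)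
    have "?F (Sup S) = v"
      using sup y D.cdf_nondecreasing[OF cSup_upper[OF yS bdd]] by (auto simp: S_def)
    moreover have "\<P>(\<omega> in M. ?F (Y \<omega>) \<le> v) = ?F (Sup S)"
      unfolding F_eq[of "Sup S"] using S_eq by (intro arg_cong[of _ _ prob]) (auto simp: S_def)
    ultimately show ?thesis by simp
  qed
  consider "u = 0" | "u = 1" | "0 < u" "u < 1" using u by linarith
  then show ?thesis
  proof cases
    case 1
    have "\<P>(\<omega> in M. ?F (Y \<omega>) \<le> 0) \<le> 0 + e" if "0 < e" for e
    proof -
      \<comment> \<open>the minimum keeps the level below 1, where the case already treated applies\<close>
      have "\<P>(\<omega> in M. ?F (Y \<omega>) \<le> 0) \<le> \<P>(\<omega> in M. ?F (Y \<omega>) \<le> min e (1/2))"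
        using that by (intro finite_measure_mono) (auto, measurable)
      also have "\<dots> \<le> e" using that by (subst inner) auto
      finally show ?thesis by simp
    qed
    then have "\<P>(\<omega> in M. ?F (Y \<omega>) \<le> 0) \<le> 0" by (rule field_le_epsilon)
    then show ?thesis by (simp add: 1 antisym)
  next
    case 2
    then show ?thesis using D.cdf_bounded_prob by (simp add: prob_space)
  qed (simp add: inner)
qed

end

section \<open>Conditionally independent copies\<close>

text \<open>The situation of the theorem on the extended probability space, where both \<open>Y\<close> and its copy
  live. The values of \<open>X\<close> enter only through the \<open>\<sigma>\<close>-algebra \<open>\<sigma>X\<close>, so they may lie in any
  topological space.\<close>
locale conditional_copy = prob_space N for N :: "'b measure" +
  fixes Y Y' :: "'b \<Rightarrow> real" and X :: "'b \<Rightarrow> 'c::topological_space"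
  assumes Y_measurable [measurable]: "Y \<in> borel_measurable N"
    and X_measurable [measurable]: "X \<in> borel_measurable N"
    and copy: "cond_iid_copy N Y Y' X"
    and continuous_cdf: "continuous_on UNIV (dist_fun N Y)"
begin

lemma Y'_measurable [measurable]: "Y' \<in> borel_measurable N"
  using copy by (simp add: cond_iid_copy_def)

abbreviation "\<sigma>X \<equiv> vimage_algebra (space N) X borel"

lemma sets_\<sigma>X: "sets \<sigma>X = {X -` B \<inter> space N | B. B \<in> sets borel}"
  by (rule sets_vimage_algebra2) auto

sublocale \<sigma>X: finite_measure_subalgebra N \<sigma>X
  by unfold_locales (auto simp: subalgebra_def sets_\<sigma>X)

lemma expectation_cond_prob:
  assumes "E \<in> events"
  shows "integrable N (cond_prob_given N X E)" "expectation (cond_prob_given N X E) = prob E"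
proof -
  have "integrable N (indicator E :: 'b \<Rightarrow> real)"
    using assms by (simp add: integrable_indicator_iff emeasure_eq_measure)
  then show "integrable N (cond_prob_given N X E)" "expectation (cond_prob_given N X E) = prob E"
    using \<sigma>X.real_cond_exp_int[of "indicator E :: 'b \<Rightarrow> real"] sets.sets_into_space[OF assms]
    by (simp_all add: cond_prob_given_def Int_absorb1 Int_absorb2)
qed

lemma cond_prob_joint:
  assumes "A \<in> sets borel" "B \<in> sets borel"
  shows "AE \<omega> in N. cond_prob_given N X {\<omega>\<in>space N. Y \<omega> \<in> A \<and> Y' \<omega> \<in> B} \<omega> =
        cond_prob_given N X {\<omega>\<in>space N. Y \<omega> \<in> A} \<omega> *
        cond_prob_given N X {\<omega>\<in>space N. Y \<omega> \<in> B} \<omega>"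
  using copy assms by (simp add: cond_iid_copy_def)

text \<open>Both claims transfer from the conditional probability of the joint event, which equals the
  product almost surely.
  In this way integrability of the product comes from that of a single conditional probability.\<close>
lemma expectation_cond_prob_mult:
  assumes [measurable]: "A \<in> sets borel" "B \<in> sets borel"
  defines "g \<equiv> \<lambda>\<omega>. cond_prob_given N X {\<omega>\<in>space N. Y \<omega> \<in> A} \<omega> *
    cond_prob_given N X {\<omega>\<in>space N. Y \<omega> \<in> B} \<omega>"
  shows "integrable N g" "expectation g = \<P>(\<omega> in N. Y \<omega> \<in> A \<and> Y' \<omega> \<in> B)"
proof -
  let ?J = "{\<omega>\<in>space N. Y \<omega> \<in> A \<and> Y' \<omega> \<in> B}"
  have ae: "AE \<omega> in N. cond_prob_given N X ?J \<omega> = g \<omega>"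
    unfolding g_def by (rule cond_prob_joint) fact+
  have [measurable]: "g \<in> borel_measurable N" "cond_prob_given N X ?J \<in> borel_measurable N"
    by (simp_all add: g_def cond_prob_given_def)
  have J: "?J \<in> events" by measurable
  show "integrable N g" 
    using expectation_cond_prob(1)[OF J] ae by (subst (asm) integrable_cong_AE) auto
  show "expectation g = prob ?J"
    using expectation_cond_prob(2)[OF J] ae by (subst (asm) integral_cong_AE) auto
qed

text \<open>Equality in law is contained in the product rule: take the whole line as the
  event for \<open>Y\<close>.\<close>
lemma Y'_same_law:
  assumes [measurable]: "B \<in> sets borel"
  shows "\<P>(\<omega> in N. Y' \<omega> \<in> B) = \<P>(\<omega> in N. Y \<omega> \<in> B)"
proof -
  let ?h = "cond_prob_given N X {\<omega>\<in>space N. Y \<omega> \<in> B}"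
  have top: "{\<omega>\<in>space N. Y \<omega> \<in> UNIV} = space N" by auto
  have one: "AE \<omega> in N. cond_prob_given N X (space N) \<omega> = indicator (space N) \<omega>"
    unfolding cond_prob_given_def
    using sets.top[of \<sigma>X]
    by (intro \<sigma>X.real_cond_exp_F_meas) (auto simp: integrable_indicator_iff emeasure_eq_measure)
  have "\<P>(\<omega> in N. Y' \<omega> \<in> B) = expectation (\<lambda>\<omega>. cond_prob_given N X (space N) \<omega> * ?h \<omega>)"
    using expectation_cond_prob_mult(2)[of UNIV B] by (simp add: top)
  also have "\<dots> = expectation ?h"
    using one by (intro integral_cong_AE) (auto simp: cond_prob_given_def)
  finally show ?thesis by (simp add: expectation_cond_prob)
qed

section \<open>The conditional distribution function of the transformed variable\<close>

abbreviation "F \<equiv> dist_fun N Y"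
definition "U \<omega> = F (Y \<omega>)"
definition "U' \<omega> = F (Y' \<omega>)"
definition "h u = cond_prob_given N X {\<omega>\<in>space N. U \<omega> \<le> u}"

lemma F_measurable [measurable]: "F \<in> borel_measurable borel"
  using continuous_cdf by (rule borel_measurable_continuous_onI)

lemma U_measurable [measurable]: "U \<in> borel_measurable N" "U' \<in> borel_measurable N"
  unfolding U_def U'_def by measurable

lemma F_bounds: "0 \<le> F y" "F y \<le> 1"
proof -
  interpret D: real_distribution "distr N borel Y" by simp
  show "0 \<le> F y" "F y \<le> 1" by (rule D.cdf_nonneg D.cdf_bounded_prob)+
qed

lemma U_bounds: "0 \<le> U \<omega>" "U \<omega> \<le> 1" "0 \<le> U' \<omega>" "U' \<omega> \<le> 1"
  by (simp_all add: U_def U'_def F_bounds)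

lemma h_measurable [measurable]: "h u \<in> borel_measurable N"
  by (simp add: h_def cond_prob_given_def)

lemma U_uniform:
  assumes "0 \<le> u" "u \<le> 1"
  shows "\<P>(\<omega> in N. U \<omega> \<le> u) = u" "\<P>(\<omega> in N. U' \<omega> \<le> u) = u"
proof -
  show *: "\<P>(\<omega> in N. U \<omega> \<le> u) = u"
    unfolding U_def by (rule prob_integral_transform) (use assms continuous_cdf in auto)
  have "F -` {..u} \<in> sets borel"
    using measurable_sets[OF F_measurable, of "{..u}"] by simp
  from Y'_same_law[OF this] * show "\<P>(\<omega> in N. U' \<omega> \<le> u) = u"
    by (simp add: U_def U'_def)
qed

text \<open>The mean of \<open>h u\<close> is \<open>u\<close> by uniformity, and its second moment is a joint
  probability by the product rule. The joint event is written through \<open>max U U'\<close>, so that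
  as a function of \<open>u\<close> its probability is a distribution function.\<close>
lemma variance_h:
  assumes u: "0 \<le> u" "u \<le> 1"
  shows "integrable N (\<lambda>\<omega>. (h u \<omega> - u)\<^sup>2)"
    "expectation (\<lambda>\<omega>. (h u \<omega> - u)\<^sup>2) = \<P>(\<omega> in N. max (U \<omega>) (U' \<omega>) \<le> u) - u\<^sup>2"
proof -
  have S: "F -` {..u} \<in> sets borel"
    using measurable_sets[OF F_measurable, of "{..u}"] by simp
  have sq: "integrable N (\<lambda>\<omega>. h u \<omega> * h u \<omega>)"
    "expectation (\<lambda>\<omega>. h u \<omega> * h u \<omega>) = \<P>(\<omega> in N. max (U \<omega>) (U' \<omega>) \<le> u)"
    using expectation_cond_prob_mult[OF S S] by (simp_all add: h_def U_def U'_def)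
  have lin: "integrable N (h u)" "expectation (h u) = u"
    using expectation_cond_prob[of "{\<omega>\<in>space N. U \<omega> \<le> u}"] U_uniform(1)[OF u] by (simp_all add: h_def)
  have eq: "(\<lambda>\<omega>. (h u \<omega> - u)\<^sup>2) = (\<lambda>\<omega>. h u \<omega> * h u \<omega> - 2 * u * h u \<omega> + u\<^sup>2)"
    by (auto simp: power2_eq_square algebra_simps)
  show "integrable N (\<lambda>\<omega>. (h u \<omega> - u)\<^sup>2)"
    unfolding eq using sq lin by auto
  show "expectation (\<lambda>\<omega>. (h u \<omega> - u)\<^sup>2) = \<P>(\<omega> in N. max (U \<omega>) (U' \<omega>) \<le> u) - u\<^sup>2"
    unfolding eq using sq lin by (simp add: prob_space power2_eq_square)
qed

lemma max_cdf_ge: 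
  assumes u: "0 \<le> u" "u \<le> 1"
  shows "u\<^sup>2 \<le> \<P>(\<omega> in N. max (U \<omega>) (U' \<omega>) \<le> u)"
  using variance_h(2)[OF u] Bochner_Integration.integral_nonneg[of N "\<lambda>\<omega>. (h u \<omega> - u)\<^sup>2"] by simp

lemma max_cdf_eq_iff:
  assumes u: "0 \<le> u" "u \<le> 1"
  shows "\<P>(\<omega> in N. max (U \<omega>) (U' \<omega>) \<le> u) = u\<^sup>2 \<longleftrightarrow> (AE \<omega> in N. h u \<omega> = u)"
  using variance_h(2)[OF u] integral_nonneg_eq_0_iff_AE[OF variance_h(1)[OF u]] by simp

text \<open>Conditional expectations are characterized by their integrals over the sets of \<open>\<sigma>X\<close>, here
  the preimages of Borel sets under \<open>X\<close>.\<close>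
lemma h_const_iff:
  assumes u: "0 \<le> u" "u \<le> 1"
  shows "(AE \<omega> in N. h u \<omega> = u) \<longleftrightarrow>
    (\<forall>B\<in>sets borel. \<P>(\<omega> in N. U \<omega> \<le> u \<and> X \<omega> \<in> B) = u * \<P>(\<omega> in N. X \<omega> \<in> B))"
proof -
  let ?E = "{\<omega>\<in>space N. U \<omega> \<le> u}"
  have int: "integrable N (indicator ?E :: 'b \<Rightarrow> real)"
    by (simp add: integrable_indicator_iff emeasure_eq_measure)
  have joint: "(LINT \<omega>:X -` B \<inter> space N|N. indicator ?E \<omega>) = \<P>(\<omega> in N. U \<omega> \<le> u \<and> X \<omega> \<in> B)"
    if [measurable]: "B \<in> sets borel" for B
  proof -
    have "(LINT \<omega>:X -` B \<inter> space N|N. indicator ?E \<omega>)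
        = (LINT \<omega>|N. indicator {\<omega> \<in> space N. U \<omega> \<le> u \<and> X \<omega> \<in> B} \<omega> :: real)"
      unfolding set_lebesgue_integral_def by (intro Bochner_Integration.integral_cong) (auto simp: indicator_def)
    then show ?thesis by simp
  qed
  have const: "(LINT \<omega>:X -` B \<inter> space N|N. u) = u * \<P>(\<omega> in N. X \<omega> \<in> B)"
    if [measurable]: "B \<in> sets borel" for B
  proof -
    have "X -` B \<inter> space N = {\<omega> \<in> space N. X \<omega> \<in> B}" by auto
    then show ?thesis by (simp add: set_lebesgue_integral_def)
  qed
  show ?thesis
  proof (intro iffI ballI)
    fix B assume ae: "AE \<omega> in N. h u \<omega> = u" and B [measurable]: "B \<in> sets (borel :: 'c measure)"
    have "(LINT \<omega>:X -` B \<inter> space N|N. indicator ?E \<omega>) = (LINT \<omega>:X -` B \<inter> space N|N. h u \<omega>)"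
      unfolding h_def cond_prob_given_def
      by (rule \<sigma>X.real_cond_exp_intA[OF int]) (use B in \<open>auto simp: sets_\<sigma>X\<close>)
    also have "\<dots> = (LINT \<omega>:X -` B \<inter> space N|N. u)"
      unfolding set_lebesgue_integral_def using ae by (intro integral_cong_AE) auto
    finally show "\<P>(\<omega> in N. U \<omega> \<le> u \<and> X \<omega> \<in> B) = u * \<P>(\<omega> in N. X \<omega> \<in> B)"
      using joint[OF B] const[OF B] by simp
  next
    assume "\<forall>B\<in>sets borel. \<P>(\<omega> in N. U \<omega> \<le> u \<and> X \<omega> \<in> B) = u * \<P>(\<omega> in N. X \<omega> \<in> B)"
    then show "AE \<omega> in N. h u \<omega> = u"
      unfolding h_def cond_prob_given_def
      by (intro \<sigma>X.real_cond_exp_charact int) (auto simp: sets_\<sigma>X joint const)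
  qed
qed

text \<open>For the direction from right to left, independence has to be shown only for the events
  \<open>Y \<le> y\<close>, since half-lines are an intersection-stable generator. The event \<open>Y \<le> y\<close>
  is contained in \<open>U \<le> F y\<close>, and both have probability \<open>F y\<close>, so they agree up to a null
  set. The inclusion may be strict where \<open>F\<close> is constant.\<close>
lemma indep_iff_h_const:
  "indep_rv N Y X \<longleftrightarrow> (\<forall>u\<in>{0..1}. AE \<omega> in N. h u \<omega> = u)"
proof
  assume indep: "indep_rv N Y X"
  show "\<forall>u\<in>{0..1}. AE \<omega> in N. h u \<omega> = u"
  proof
    fix u :: real assume "u \<in> {0..1}"
    then have u: "0 \<le> u" "u \<le> 1" by auto
    have S: "F -` {..u} \<in> sets borel"
      using measurable_sets[OF F_measurable, of "{..u}"] by simp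
    show "AE \<omega> in N. h u \<omega> = u"
      unfolding h_const_iff[OF u]
    proof
      fix B :: "'c set" assume B: "B \<in> sets borel"
      have "prob ((Y -` (F -` {..u}) \<inter> space N) \<inter> (X -` B \<inter> space N))
        = prob (Y -` (F -` {..u}) \<inter> space N) * prob (X -` B \<inter> space N)"
        by (rule indep_setD[OF indep[unfolded indep_rv_def]]) (use S B in auto)
      moreover have "(Y -` (F -` {..u}) \<inter> space N) \<inter> (X -` B \<inter> space N)
          = {\<omega> \<in> space N. U \<omega> \<le> u \<and> X \<omega> \<in> B}"
        "Y -` (F -` {..u}) \<inter> space N = {\<omega> \<in> space N. U \<omega> \<le> u}"
        "X -` B \<inter> space N = {\<omega> \<in> space N. X \<omega> \<in> B}"
        by (auto simp: U_def)
      ultimately show "\<P>(\<omega> in N. U \<omega> \<le> u \<and> X \<omega> \<in> B) = u * \<P>(\<omega> in N. X \<omega> \<in> B)"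
        using U_uniform(1)[OF u] by simp
    qed
  qed
next
  assume const: "\<forall>u\<in>{0..1}. AE \<omega> in N. h u \<omega> = u"
  interpret D: real_distribution "distr N borel Y" by simp
  let ?G = "{Y -` A \<inter> space N | A. A \<in> range (\<lambda>y. {..y})}"
  let ?H = "{X -` B \<inter> space N | B. B \<in> sets borel}"
  have half_line: "prob ({\<omega> \<in> space N. Y \<omega> \<le> y} \<inter> {\<omega> \<in> space N. X \<omega> \<in> B})
      = prob {\<omega> \<in> space N. Y \<omega> \<le> y} * prob {\<omega> \<in> space N. X \<omega> \<in> B}"
    if [measurable]: "B \<in> sets borel" for y B
  proof -
    have F_eq: "F y = \<P>(\<omega> in N. Y \<omega> \<le> y)"
      by (simp add: cdf_def measure_distr vimage_def Int_def conj_commute)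
    have sub: "U \<omega> \<le> F y" if "Y \<omega> \<le> y" for \<omega>
      using that by (simp add: U_def D.cdf_nondecreasing)
    have null: "\<P>(\<omega> in N. U \<omega> \<le> F y \<and> \<not> Y \<omega> \<le> y) = 0"
    proof -
      have "{\<omega> \<in> space N. U \<omega> \<le> F y \<and> \<not> Y \<omega> \<le> y}
          = {\<omega> \<in> space N. U \<omega> \<le> F y} - {\<omega> \<in> space N. Y \<omega> \<le> y}" by auto
      then have "\<P>(\<omega> in N. U \<omega> \<le> F y \<and> \<not> Y \<omega> \<le> y) = \<P>(\<omega> in N. U \<omega> \<le> F y) - \<P>(\<omega> in N. Y \<omega> \<le> y)"
        using sub by (simp, subst finite_measure_Diff) auto
      then show ?thesis by (simp add: U_uniform F_bounds F_eq[symmetric])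
    qed
    have "AE \<omega> in N. \<not> (U \<omega> \<le> F y \<and> \<not> Y \<omega> \<le> y)"
      using null by (intro AE_I[of _ _ "{\<omega> \<in> space N. U \<omega> \<le> F y \<and> \<not> Y \<omega> \<le> y}"]) (auto simp: emeasure_eq_measure)
    then have "prob ({\<omega> \<in> space N. Y \<omega> \<le> y} \<inter> {\<omega> \<in> space N. X \<omega> \<in> B}) = \<P>(\<omega> in N. U \<omega> \<le> F y \<and> X \<omega> \<in> B)"
      using sub by (intro finite_measure_eq_AE) auto
    also have "\<dots> = F y * \<P>(\<omega> in N. X \<omega> \<in> B)"
      using const h_const_iff[of "F y"] that by (auto simp: F_bounds)
    finally show ?thesis by (simp add: F_eq)
  qed
  have "indep_set ?G ?H"
  proof (rule indep_setI)
    fix a b assume "a \<in> ?G" "b \<in> ?H"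
    then obtain y B where "B \<in> sets borel" "a = {\<omega> \<in> space N. Y \<omega> \<le> y}" "b = {\<omega> \<in> space N. X \<omega> \<in> B}"
      by auto
    then show "prob (a \<inter> b) = prob a * prob b" by (simp only: half_line)
  qed auto
  moreover have "Int_stable ?G"
  proof (rule Int_stableI)
    fix a b assume "a \<in> ?G" "b \<in> ?G"
    then obtain y z where "a = Y -` {..y} \<inter> space N" "b = Y -` {..z} \<inter> space N" by auto
    then have "a \<inter> b = Y -` {..min y z} \<inter> space N" by auto
    then show "a \<inter> b \<in> ?G" by blast
  qed
  moreover have "Int_stable ?H"
    by (rule Int_stableI) (auto simp: sets_\<sigma>X[symmetric])
  ultimately have "indep_set (sigma_sets (space N) ?G) (sigma_sets (space N) ?H)"
    by (rule indep_set_sigma_sets)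
  moreover have "sigma_sets (space N) ?G = {Y -` A \<inter> space N | A. A \<in> sets borel}"
    by (subst sigma_sets_vimage_commute[symmetric, of _ _ UNIV]) (auto simp: borel_eq_atMost)
  moreover have "sigma_sets (space N) ?H = ?H"
    using sets.sigma_sets_eq[of \<sigma>X] by (simp add: sets_\<sigma>X)
  ultimately show "indep_rv N Y X"
    by (simp add: indep_rv_def)
qed

section \<open>The value of kappa at 1\<close>

lemma phi_eq: "phi N Y Y' s = \<P>(\<omega> in N. \<bar>U \<omega> - U' \<omega>\<bar> \<le> s)"
  by (simp add: phi_def U_def U'_def)

lemma integrable_tail:
  assumes [measurable]: "Z \<in> borel_measurable N"
  shows "set_integrable lborel {a..b::real} (\<lambda>s. 1 - \<P>(\<omega> in N. Z \<omega> \<le> s))"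
proof -
  have "mono (\<lambda>s. \<P>(\<omega> in N. Z \<omega> \<le> s))"
    by (auto intro!: monoI finite_measure_mono)
  then have "(\<lambda>s. \<P>(\<omega> in N. Z \<omega> \<le> s)) \<in> borel_measurable lborel"
    by (simp add: borel_measurable_mono)
  then show ?thesis
    unfolding set_integrable_def
    by (intro integrableI_bounded_set_indicator[where B=1]) (auto simp: emeasure_lborel_Icc_eq)
qed

lemma expectation_U: "expectation U = 1/2" "expectation U' = 1/2"
proof -
  have "(LINT u:{0..1}|lborel. 1 - u) = (1/2 :: real)"
  proof -
    have "has_bochner_integral lborel (\<lambda>u. (1 - u) * indicator {0..1} u) ((1 - 1\<^sup>2/2) - (0 - 0\<^sup>2/2) :: real)"
      by (rule has_bochner_integral_FTC_Icc_real) (auto intro!: derivative_eq_intros continuous_intros)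
    then show ?thesis
      by (simp add: has_bochner_integral_iff set_lebesgue_integral_def mult.commute)
  qed
  moreover have "(LINT u:{0..1}|lborel. 1 - \<P>(\<omega> in N. V \<omega> \<le> u)) = (LINT u:{0..1}|lborel. 1 - u)"
    if "\<And>u. 0 \<le> u \<Longrightarrow> u \<le> 1 \<Longrightarrow> \<P>(\<omega> in N. V \<omega> \<le> u) = u" for V
    unfolding set_lebesgue_integral_def using that
    by (intro Bochner_Integration.integral_cong) (auto simp: indicator_def)
  ultimately show "expectation U = 1/2" "expectation U' = 1/2"
    by (simp_all add: expectation_eq_integral_tail U_bounds U_uniform)
qed

text \<open>From \<open>\<bar>U - U'\<bar> = 2 max U U' - U - U'\<close> and the means \<open>1/2\<close> one gets
  \<open>\<kappa>(1) = 4 - 6 E(max U U')\<close>. Subtracting \<open>u\<^sup>2\<close> under the tail integral accounts for the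
  constant, as \<open>1 - u\<^sup>2\<close> has integral \<open>2/3\<close>.\<close>
lemma kappa_1_eq:
  "kappa N Y Y' 1 = 6 * (LINT u:{0..1}|lborel. \<P>(\<omega> in N. max (U \<omega>) (U' \<omega>) \<le> u) - u\<^sup>2)"
proof -
  let ?W = "\<lambda>\<omega>. max (U \<omega>) (U' \<omega>)"
  have int: "integrable N U" "integrable N U'" "integrable N ?W"
    using U_bounds by (auto intro!: integrable_const_bound[of _ 1] simp: max_def)
  have "kappa N Y Y' 1 = 1 - 3 * expectation (\<lambda>\<omega>. \<bar>U \<omega> - U' \<omega>\<bar>)"
  proof -
    have "\<bar>U \<omega> - U' \<omega>\<bar> \<le> 1" for \<omega>
      using U_bounds[of \<omega>] by linarith
    then show ?thesis
      unfolding kappa_def phi_eq by (subst expectation_eq_integral_tail) auto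
  qed
  also have "(\<lambda>\<omega>. \<bar>U \<omega> - U' \<omega>\<bar>) = (\<lambda>\<omega>. 2 * ?W \<omega> - U \<omega> - U' \<omega>)"
    by auto
  also have "expectation \<dots> = 2 * expectation ?W - 1"
    using int by (simp add: expectation_U)
  also have "expectation ?W = (LINT u:{0..1}|lborel. 1 - \<P>(\<omega> in N. ?W \<omega> \<le> u))"
    using U_bounds by (intro expectation_eq_integral_tail) (auto simp: le_max_iff_disj)
  finally have kappa: "kappa N Y Y' 1 = 4 - 6 * (LINT u:{0..1}|lborel. 1 - \<P>(\<omega> in N. ?W \<omega> \<le> u))"
    by simp
  have sq: "has_bochner_integral lborel (\<lambda>u. indicator {0..1} u *\<^sub>R (1 - u\<^sup>2)) (2/3 :: real)"
  proof -
    have "has_bochner_integral lborel (\<lambda>u. (1 - u\<^sup>2) * indicator {0..1} u) ((1 - 1^3/3) - (0 - 0^3/3) :: real)"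
      by (rule has_bochner_integral_FTC_Icc_real) (auto intro!: derivative_eq_intros continuous_intros)
    then show ?thesis by (simp add: mult.commute)
  qed
  then have sq: "set_integrable lborel {0..1} (\<lambda>u::real. 1 - u\<^sup>2)" "(LINT u:{0..1}|lborel. 1 - u\<^sup>2) = (2/3::real)"
    by (auto simp: has_bochner_integral_iff set_integrable_def set_lebesgue_integral_def)
  have "(LINT u:{0..1}|lborel. \<P>(\<omega> in N. ?W \<omega> \<le> u) - u\<^sup>2)
      = (LINT u:{0..1}|lborel. (1 - u\<^sup>2) - (1 - \<P>(\<omega> in N. ?W \<omega> \<le> u)))"
    by simp
  also have "\<dots> = 2/3 - (LINT u:{0..1}|lborel. 1 - \<P>(\<omega> in N. ?W \<omega> \<le> u))"
    using sq integrable_tail[of ?W 0 1] by (subst set_integral_diff) auto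
  finally show ?thesis
    using kappa by simp
qed

lemma kappa_1_le:
  assumes "t \<le> 1"
  shows "kappa N Y Y' 1 \<le> kappa N Y Y' t"
proof -
  have "(LINT s:{0..t}|lborel. 1 - phi N Y Y' s) \<le> (LINT s:{0..1}|lborel. 1 - phi N Y Y' s)"
    unfolding set_lebesgue_integral_def phi_eq
    using integrable_tail[of "\<lambda>\<omega>. \<bar>U \<omega> - U' \<omega>\<bar>"] assms
    by (intro integral_mono) (auto simp: set_integrable_def indicator_def)
  then show ?thesis by (simp add: kappa_def)
qed

lemma kappa_1_nonneg: "0 \<le> kappa N Y Y' 1"
proof -
  have "0 \<le> indicator {0..1} u *\<^sub>R (\<P>(\<omega> in N. max (U \<omega>) (U' \<omega>) \<le> u) - u\<^sup>2)" for u :: real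
    using max_cdf_ge[of u] by (simp add: indicator_def del: max.bounded_iff)
  then show ?thesis
    unfolding kappa_1_eq set_lebesgue_integral_def
    by (intro mult_nonneg_nonneg Bochner_Integration.integral_nonneg) auto
qed

text \<open>The integrand in the formula for \<open>\<kappa>(1)\<close> is nonnegative, so a zero integral makes it vanish
  almost everywhere. It is also right-continuous: if it were nonzero at some \<open>u < 1\<close>, it
  would be nonzero on a whole interval to the right of \<open>u\<close>.\<close>
lemma kappa_1_eq_0_iff:
  "kappa N Y Y' 1 = 0 \<longleftrightarrow> (\<forall>u\<in>{0..1}. \<P>(\<omega> in N. max (U \<omega>) (U' \<omega>) \<le> u) = u\<^sup>2)"
proof
  assume "\<forall>u\<in>{0..1}. \<P>(\<omega> in N. max (U \<omega>) (U' \<omega>) \<le> u) = u\<^sup>2"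
  then have "(LINT u:{0..1}|lborel. \<P>(\<omega> in N. max (U \<omega>) (U' \<omega>) \<le> u) - u\<^sup>2) = (LINT u:{0..1::real}|lborel. (0::real))"
    unfolding set_lebesgue_integral_def
    by (intro Bochner_Integration.integral_cong) (auto simp: indicator_def)
  then show "kappa N Y Y' 1 = 0"
    by (simp add: kappa_1_eq)
next
  let ?W = "\<lambda>\<omega>. max (U \<omega>) (U' \<omega>)"
  let ?d = "\<lambda>u. \<P>(\<omega> in N. ?W \<omega> \<le> u) - u\<^sup>2"
  interpret W: real_distribution "distr N borel ?W" by simp
  have cdf_W: "cdf (distr N borel ?W) u = \<P>(\<omega> in N. ?W \<omega> \<le> u)" for u
    by (simp add: cdf_def measure_distr vimage_def Int_def conj_commute del: max.bounded_iff)
  assume "kappa N Y Y' 1 = 0"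
  then have int0: "(LINT u|lborel. indicator {0..1} u * ?d u) = 0"
    by (simp add: kappa_1_eq set_lebesgue_integral_def)
  have int: "integrable lborel (\<lambda>u. indicator {0..1} u * ?d u)"
  proof -
    have "set_integrable lborel {0..1} (\<lambda>u. (1 - u\<^sup>2) - (1 - \<P>(\<omega> in N. ?W \<omega> \<le> u)))"
      by (intro set_integral_diff integrable_tail borel_integrable_atLeastAtMost' continuous_intros) auto
    then show ?thesis by (simp add: set_integrable_def)
  qed
  have ae: "AE u in lborel. indicator {0..1} u * ?d u = 0"
    using int0 max_cdf_ge integral_nonneg_eq_0_iff_AE[OF int]
    by (auto simp: indicator_def)
  show "\<forall>u\<in>{0..1}. \<P>(\<omega> in N. ?W \<omega> \<le> u) = u\<^sup>2"
  proof
    fix u :: real assume u: "u \<in> {0..1}"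
    show "\<P>(\<omega> in N. ?W \<omega> \<le> u) = u\<^sup>2"
    proof (cases "u = 1")
      case True
      then show ?thesis using U_bounds by (simp add: prob_space)
    next
      case False
      show ?thesis
      proof (rule ccontr)
        assume ne: "\<P>(\<omega> in N. ?W \<omega> \<le> u) \<noteq> u\<^sup>2"
        have "(?d \<longlongrightarrow> ?d u) (at_right u)"
          using W.cdf_is_right_cont[of u] unfolding continuous_within cdf_W
          by (intro tendsto_intros) auto
        from tendsto_imp_eventually_ne[OF this, of 0] ne
        obtain b where b: "u < b" "\<And>v. u < v \<Longrightarrow> v < b \<Longrightarrow> ?d v \<noteq> 0"
          unfolding eventually_at_right_field by auto
        have "AE v in lborel. v \<notin> {u<..<min b 1}"
          using ae by eventually_elim (use b u in \<open>force simp: indicator_def\<close>)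
        then have "{u<..<min b 1} \<in> null_sets lborel"
          by (subst AE_iff_null_sets) auto
        then show False using b(1) u False by (simp add: null_sets_def)
      qed
    qed
  qed
qed

lemma kappa_1_eq_0_iff_indep: "kappa N Y Y' 1 = 0 \<longleftrightarrow> indep_rv N Y X"
proof -
  have "(\<P>(\<omega> in N. max (U \<omega>) (U' \<omega>) \<le> u) = u\<^sup>2) \<longleftrightarrow> (AE \<omega> in N. h u \<omega> = u)"
    if "u \<in> {0..1}" for u
    using that by (intro max_cdf_eq_iff) auto
  then show ?thesis
    unfolding kappa_1_eq_0_iff indep_iff_h_const by (intro ball_cong refl)
qed

lemma ex_kappa_eq_0_iff: "(\<exists>t\<in>{0<..1}. kappa N Y Y' t = 0) \<longleftrightarrow> kappa N Y Y' 1 = 0"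
proof
  assume "\<exists>t\<in>{0<..1}. kappa N Y Y' t = 0"
  then obtain t where "t \<le> 1" "kappa N Y Y' t = 0" by auto
  then show "kappa N Y Y' 1 = 0"
    using kappa_1_le[of t] kappa_1_nonneg by simp
next
  assume "kappa N Y Y' 1 = 0"
  then show "\<exists>t\<in>{0<..1}. kappa N Y Y' t = 0"
    by (intro bexI[of _ 1]) auto
qed

end

section \<open>Return to the original probability space\<close>

text \<open>Independence is a property of the joint law, which composition with the
  measure-preserving map \<open>p\<close> does not change.\<close>
lemma indep_rv_extension:
  assumes "prob_space M" "extends_prob_space M N p"
    and [measurable]: "Y \<in> borel_measurable M" "X \<in> borel_measurable M"
  shows "indep_rv N (Y \<circ> p) (X \<circ> p) \<longleftrightarrow> indep_rv M Y X"
proof -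
  interpret M: prob_space M by fact
  interpret N: prob_space N using assms by (simp add: extends_prob_space_def)
  have p [measurable]: "p \<in> measurable N M" and distr: "distr N M p = M"
    using assms by (simp_all add: extends_prob_space_def)
  have prob: "measure N (p -` E \<inter> space N) = measure M E" if "E \<in> sets M" for E
    using measure_distr[OF p that] by (simp add: distr)
  have pre: "(f \<circ> p) -` A \<inter> space N = p -` (f -` A \<inter> space M) \<inter> space N" for f :: "'a \<Rightarrow> 'e" and A
    using measurable_space[OF p] by auto
  have joint: "(p -` E \<inter> space N) \<inter> (p -` G \<inter> space N) = p -` (E \<inter> G) \<inter> space N" for E G
    by auto
  have "indep_rv N (Y \<circ> p) (X \<circ> p) \<longleftrightarrow> (\<forall>A\<in>sets borel. \<forall>B\<in>sets borel.
    measure N (((Y \<circ> p) -` A \<inter> space N) \<inter> ((X \<circ> p) -` B \<inter> space N))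
    = measure N ((Y \<circ> p) -` A \<inter> space N) * measure N ((X \<circ> p) -` B \<inter> space N))"
    using measurable_sets[of "Y \<circ> p" N borel] measurable_sets[of "X \<circ> p" N borel]
    unfolding indep_rv_def N.indep_sets2_eq Setcompr_eq_image ball_simps image_subset_iff
    by simp
  also have "\<dots> \<longleftrightarrow> (\<forall>A\<in>sets borel. \<forall>B\<in>sets borel.
    measure M ((Y -` A \<inter> space M) \<inter> (X -` B \<inter> space M))
    = measure M (Y -` A \<inter> space M) * measure M (X -` B \<inter> space M))"
  proof -
    have "Y -` A \<inter> space M \<in> sets M" "X -` B \<inter> space M \<in> sets M"
      if "A \<in> sets borel" "B \<in> sets borel" for A B
      using that by measurable
    then show ?thesis
      by (intro ball_cong refl) (simp only: joint pre prob sets.Int)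
  qed
  also have "\<dots> \<longleftrightarrow> indep_rv M Y X"
    using measurable_sets[of Y M borel] measurable_sets[of X M borel]
    unfolding indep_rv_def M.indep_sets2_eq Setcompr_eq_image ball_simps image_subset_iff
    by simp
  finally show ?thesis .
qed

theorem theorem2p5:
  fixes M :: "'a measure" and Y :: "'a \<Rightarrow> real" and X :: "'a \<Rightarrow> real ^ 'd"
    and N :: "'b measure" and p :: "'b \<Rightarrow> 'a" and Y' :: "'b \<Rightarrow> real"
  assumes "prob_space M"
    and "Y \<in> borel_measurable M"
    and "X \<in> borel_measurable M"
    and "continuous_on UNIV (dist_fun M Y)"
    and "extends_prob_space M N p"
    and "cond_iid_copy N (Y \<circ> p) Y' (X \<circ> p)"
  shows "((\<exists>t\<in>{0<..1}. kappa N (Y \<circ> p) Y' t = 0) \<longleftrightarrow> kappa N (Y \<circ> p) Y' 1 = 0)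
    \<and> (kappa N (Y \<circ> p) Y' 1 = 0 \<longleftrightarrow> indep_rv M Y X)
    \<and> (indep_rv M Y X \<longleftrightarrow> kappa N (Y \<circ> p) Y' 1 = kappa_indep 1)"
proof -
  have p [measurable]: "p \<in> measurable N M" and distr: "distr N M p = M" and N: "prob_space N"
    using assms(5) by (simp_all add: extends_prob_space_def)
  note [measurable] = assms(2,3)
  have "distr N borel (Y \<circ> p) = distr (distr N M p) borel Y"
    by (rule distr_distr[symmetric]) measurable
  then have "dist_fun N (Y \<circ> p) = dist_fun M Y"
    by (simp add: distr)
  then interpret conditional_copy N "Y \<circ> p" Y' "X \<circ> p"
    using N assms(4,6) by (intro conditional_copy.intro conditional_copy_axioms.intro) auto
  have "kappa_indep 1 = 0"
    by (simp add: kappa_indep_def)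
  then show ?thesis
    using ex_kappa_eq_0_iff kappa_1_eq_0_iff_indep indep_rv_extension[OF assms(1,5,2,3)] by simp
qed

end
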